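(* Let $\varphi$ be a convex function with $L$-Lipschitz-continuous gradient, let $\Lambda$ be a closed convex set, and let the sequences $\{\lambda_k,\eta_k,\zeta_k\}$, $k\ge0$, be generated by the Adaptive Similar Triangles Method (ASTM) described in the context, started with an initial guess $L_0>0$. Suppose $\min_{\lambda\in\Lambda}\varphi(\lambda)$ is attained and let $\lambda_*$ be the solution of $\min_{\lambda\in\Lambda}\varphi(\lambda)$ such that $V[\zeta_0](\lambda_* )$ is minimal among all the solutions. Then, for all $k\ge1$, $$\varphi(\eta_k)-\min_{\lambda\in\Lambda}\varphi(\lambda)\le\frac{8L\,V[\zeta_0](\lambda_* )}{(k+1)^2}.$$
   Context: Setting. $E$ is a finite-dimensional real vector space with norm $\|\cdot\|$ and dual norm $\|\cdot\|_*$ on $E^*$; $\langle g,x\rangle$ is the value of $g\in E^*$ at $x\in E$. $\Lambda\subseteq E$ is a nonempty closed convex (possibly unbounded) set. $\varphi:E\to\mathbb{R}$ is convex and differentiable, with $\|\nabla\varphi(x)-\nabla\varphi(y)\|_*\le L\|x-y\|$ for all $x,y\in E$, where $L>0$. Prox-setup. $d:\Lambda\to\mathbb{R}$ is continuous and convex on $\Lambda$; $\Lambda^0\subseteq\Lambda$ is the set of points at which $d$ has a subgradient (relative to $\Lambda$); $\nabla d(\lambda)$, $\lambda\in\Lambda^0$, is a selection of subgradients that is continuous on $\Lambda^0$; and $d$ is $1$-strongly convex: $d(\eta)-d(\lambda)-\langle\nabla d(\lambda),\eta-\lambda\rangle\ge\frac12\|\eta-\lambda\|^2$ for all $\lambda\in\Lambda^0$,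 $\eta\in\Lambda$. The Bregman divergence is $V[\zeta](\lambda)=d(\lambda)-d(\zeta)-\langle\nabla d(\zeta),\lambda-\zeta\rangle$, $\lambda\in\Lambda$, $\zeta\in\Lambda^0$. Algorithm ASTM. Input: $\lambda_0\in\Lambda^0$ and $L_0>0$. Set $C_0=\alpha_0=0$, $\eta_0=\zeta_0=\lambda_0$. For $k=0,1,2,\dots$ (outer iterations; the outer loop is continued indefinitely, i.e. stopping is ignored): set $M_k=L_k/2$ and run the inner loop: repeat (i) set $M_k:=2M_k$ and let $\alpha_{k+1}$ be the largest root of $C_k+\alpha_{k+1}=M_k\alpha_{k+1}^2$, and put $C_{k+1}:=C_k+\alpha_{k+1}$; (ii) $\lambda_{k+1}=(\alpha_{k+1}\zeta_k+C_k\eta_k)/C_{k+1}$; (iii) $\zeta_{k+1}=\arg\min_{\lambda\in\Lambda}\{V[\zeta_k](\lambda)+\alpha_{k+1}(\varphi(\lambda_{k+1})+\langle\nabla\varphi(\lambda_{k+1}),\lambda-\lambda_{k+1}\rangle)\}$; (iv) $\eta_{k+1}=(\alpha_{k+1}\zeta_{k+1}+C_k\eta_k)/C_{k+1}$; until the check $\varphi(\eta_{k+1})\le\varphi(\lambda_{k+1})+\langle\nabla\varphi(\lambda_{k+1}),\eta_{k+1}-\lambda_{k+1}\rangle+\frac{M_k}{2}\|\eta_{k+1}-\lambda_{k+1}\|^2$ holds. The values at exit of the inner loop are kept; then set $L_{k+1}=M_k/2$ and pass to the next outer iteration.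
   Formalization: The initial guess is additionally assumed to satisfy L_0 ≤ 2L; for arbitrary L_0 > 0 the bound is false (e.g. Λ=[0,1], φ(x)=−x, d(x)=x²/2, λ_0=0, L=1/10, L_0=2 violates it at k=1). *)

theory Defs
  imports "HOL-Analysis.Analysis"
begin

(* The dual space E* is the type 'a \<Rightarrow>\<^sub>L real of bounded functionals, whose library norm is
   the dual norm.  The functions phi, d and their (sub)gradients are total; d and its
   subgradient selection gd are only ever used on Lam and subgrad_dom Lam d, respectively. *)

definition subgrad_dom :: "'a::real_normed_vector set \<Rightarrow> ('a \<Rightarrow> real) \<Rightarrow> 'a set" where
  "subgrad_dom Lam d =
     {x \<in> Lam. \<exists>g :: 'a \<Rightarrow>\<^sub>L real. \<forall>y\<in>Lam. d x + blinfun_apply g (y - x) \<le> d y}"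

definition prox_setup ::
  "'a::real_normed_vector set \<Rightarrow> ('a \<Rightarrow> real) \<Rightarrow> ('a \<Rightarrow> 'a \<Rightarrow>\<^sub>L real) \<Rightarrow> bool" where
  "prox_setup Lam d gd \<longleftrightarrow>
     continuous_on Lam d \<and> convex_on Lam d \<and>
     (\<forall>x\<in>subgrad_dom Lam d. \<forall>y\<in>Lam. d x + blinfun_apply (gd x) (y - x) \<le> d y) \<and>
     continuous_on (subgrad_dom Lam d) gd \<and>
     (\<forall>x\<in>subgrad_dom Lam d. \<forall>y\<in>Lam.
        d y - d x - blinfun_apply (gd x) (y - x) \<ge> 1 / 2 * (norm (y - x))\<^sup>2)"

definition bregman ::
  "('a::real_normed_vector \<Rightarrow> real) \<Rightarrow> ('a \<Rightarrow> 'a \<Rightarrow>\<^sub>L real) \<Rightarrow> 'a \<Rightarrow> 'a \<Rightarrow> real" where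
  "bregman d gd z x = d x - d z - blinfun_apply (gd z) (x - z)"

definition linearization ::
  "('a::real_normed_vector \<Rightarrow> real) \<Rightarrow> ('a \<Rightarrow> 'a \<Rightarrow>\<^sub>L real) \<Rightarrow> 'a \<Rightarrow> 'a \<Rightarrow> real" where
  "linearization phi g l x = phi l + blinfun_apply (g l) (x - l)"

(* One pass through the loop body with trial constant M, from the current C, zeta, eta
   to the candidates a, C', lam', zeta', eta'. *)
definition astm_trial ::
  "'a::real_normed_vector set \<Rightarrow> ('a \<Rightarrow> real) \<Rightarrow> ('a \<Rightarrow> 'a \<Rightarrow>\<^sub>L real) \<Rightarrow> ('a \<Rightarrow> real) \<Rightarrow>
   ('a \<Rightarrow> 'a \<Rightarrow>\<^sub>L real) \<Rightarrow> real \<Rightarrow> 'a \<Rightarrow> 'a \<Rightarrow>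
   real \<Rightarrow> real \<Rightarrow> real \<Rightarrow> 'a \<Rightarrow> 'a \<Rightarrow> 'a \<Rightarrow> bool" where
  "astm_trial Lam phi g d gd C zeta eta M a C' lam' zeta' eta' \<longleftrightarrow>
     C + a = M * a\<^sup>2 \<and> (\<forall>b. C + b = M * b\<^sup>2 \<longrightarrow> b \<le> a) \<and>
     C' = C + a \<and>
     lam' = (a *\<^sub>R zeta + C *\<^sub>R eta) /\<^sub>R C' \<and>
     is_arg_min (\<lambda>x. bregman d gd zeta x + a * linearization phi g lam' x)
       (\<lambda>x. x \<in> Lam) zeta' \<and>
     eta' = (a *\<^sub>R zeta' + C *\<^sub>R eta) /\<^sub>R C'"

definition astm_check ::
  "('a::real_normed_vector \<Rightarrow> real) \<Rightarrow> ('a \<Rightarrow> 'a \<Rightarrow>\<^sub>L real) \<Rightarrow> real \<Rightarrow> 'a \<Rightarrow> 'a \<Rightarrow> bool" where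
  "astm_check phi g M lam' eta' \<longleftrightarrow>
     phi eta' \<le> linearization phi g lam' eta' + M / 2 * (norm (eta' - lam'))\<^sup>2"

(* The repeat-until loop: entered with the constant M (before doubling), it terminates with
   the constant M' and the values a, C', lam', zeta', eta' of the first accepted pass. *)
inductive astm_inner ::
  "'a::real_normed_vector set \<Rightarrow> ('a \<Rightarrow> real) \<Rightarrow> ('a \<Rightarrow> 'a \<Rightarrow>\<^sub>L real) \<Rightarrow> ('a \<Rightarrow> real) \<Rightarrow>
   ('a \<Rightarrow> 'a \<Rightarrow>\<^sub>L real) \<Rightarrow> real \<Rightarrow> 'a \<Rightarrow> 'a \<Rightarrow>
   real \<Rightarrow> real \<Rightarrow> real \<Rightarrow> real \<Rightarrow> 'a \<Rightarrow> 'a \<Rightarrow> 'a \<Rightarrow> bool"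
  for Lam phi g d gd C zeta eta where
  accept: "astm_inner Lam phi g d gd C zeta eta M (2 * M) a C' lam' zeta' eta'"
    if "astm_trial Lam phi g d gd C zeta eta (2 * M) a C' lam' zeta' eta'"
       "astm_check phi g (2 * M) lam' eta'"
| reject: "astm_inner Lam phi g d gd C zeta eta M M' a C' lam' zeta' eta'"
    if "astm_trial Lam phi g d gd C zeta eta (2 * M) b D l z e"
       "\<not> astm_check phi g (2 * M) l e"
       "astm_inner Lam phi g d gd C zeta eta (2 * M) M' a C' lam' zeta' eta'"

definition astm_run ::
  "'a::real_normed_vector set \<Rightarrow> ('a \<Rightarrow> real) \<Rightarrow> ('a \<Rightarrow> 'a \<Rightarrow>\<^sub>L real) \<Rightarrow> ('a \<Rightarrow> real) \<Rightarrow>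
   ('a \<Rightarrow> 'a \<Rightarrow>\<^sub>L real) \<Rightarrow>
   (nat \<Rightarrow> real) \<Rightarrow> (nat \<Rightarrow> real) \<Rightarrow> (nat \<Rightarrow> real) \<Rightarrow> (nat \<Rightarrow> real) \<Rightarrow>
   (nat \<Rightarrow> 'a) \<Rightarrow> (nat \<Rightarrow> 'a) \<Rightarrow> (nat \<Rightarrow> 'a) \<Rightarrow> bool" where
  "astm_run Lam phi g d gd Ls M alpha C lam zeta eta \<longleftrightarrow>
     lam 0 \<in> subgrad_dom Lam d \<and> Ls 0 > 0 \<and>
     C 0 = 0 \<and> alpha 0 = 0 \<and> eta 0 = lam 0 \<and> zeta 0 = lam 0 \<and>
     (\<forall>k. astm_inner Lam phi g d gd (C k) (zeta k) (eta k) (Ls k / 2)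
            (M k) (alpha (Suc k)) (C (Suc k)) (lam (Suc k)) (zeta (Suc k)) (eta (Suc k)) \<and>
          Ls (Suc k) = M k / 2)"

end

theory Submission
  imports Defs
begin

text \<open>The optimality condition of the prox step and the acceptance check show that the potential
  \<open>C\<^sub>k (phi (eta\<^sub>k) - phi x) + V[zeta\<^sub>k](x)\<close> does not increase, for every \<open>x\<close> in \<open>Lam\<close>. By the
  descent lemma a trial constant \<open>M \<ge> L\<close> is never rejected, so all accepted constants are at most
  \<open>2 L\<close>. Hence \<open>sqrt C\<^sub>k\<close> grows by at least \<open>1 / sqrt (8 L)\<close> per step, and by twice as much in the
  first one, which gives \<open>C\<^sub>k \<ge> (k + 1)\<^sup>2 / (8 L)\<close>.\<close>

section \<open>Finite-dimensional normed spaces\<close>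

text \<open>A convergent sequence is bounded, so it lies in a single ball. In the inductions below
  this turns compactness of balls in a span into closedness of the span.\<close>

lemma closed_if_compact_Int_cball:
  fixes S :: "'a::real_normed_vector set"
  assumes "\<And>r. compact (cball 0 r \<inter> S)"
  shows "closed S"
  unfolding closed_sequential_limits
proof (intro allI impI)
  fix x l assume x: "(\<forall>n. x n \<in> S) \<and> x \<longlonglongrightarrow> l"
  then have "bounded (range x)"
    using convergent_imp_bounded by blast
  then obtain r where "\<And>n. norm (x n) \<le> r"
    by (auto simp: bounded_iff)
  then have "\<forall>n. x n \<in> cball 0 r \<inter> S" using x by auto
  moreover have "closed (cball 0 r \<inter> S)" using assms compact_imp_closed by blast
  ultimately show "l \<in> S" using x closed_sequentially[of "cball 0 r \<inter> S"] by blast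
qed

text \<open>The constant \<open>e\<close> is the radius of a ball around \<open>b\<close> that
  misses the closed span: a vector off the span cannot be approximated from it, so a large
  coefficient of \<open>b\<close> forces a large norm.\<close>

lemma span_insert_coeff_bound:
  fixes b :: "'a::real_normed_vector"
  assumes "closed (span S)" "b \<notin> span S"
  obtains e where "e > 0" "\<And>k s. s \<in> span S \<Longrightarrow> e * \<bar>k\<bar> \<le> norm (k *\<^sub>R b + s)"
proof -
  have "open (- span S)" "b \<in> - span S" using assms by (auto simp: open_closed)
  then obtain e where e: "e > 0" "ball b e \<subseteq> - span S"
    by (meson open_contains_ball)
  have "e * \<bar>k\<bar> \<le> norm (k *\<^sub>R b + s)" if s: "s \<in> span S" for k s
  proof (cases "k = 0")
    case False
    have "(- 1 / k) *\<^sub>R s \<in> span S" using s span_mul by blast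
    then have "(- 1 / k) *\<^sub>R s \<notin> ball b e" using e by auto
    then have "e \<le> norm (b - (- 1 / k) *\<^sub>R s)" by (auto simp: dist_norm)
    also have "b - (- 1 / k) *\<^sub>R s = (1 / k) *\<^sub>R (k *\<^sub>R b + s)"
      using False by (simp add: algebra_simps)
    finally have "e \<le> norm (k *\<^sub>R b + s) / \<bar>k\<bar>" by simp
    then show ?thesis using False by (simp add: pos_le_divide_eq)
  qed simp
  with e(1) show thesis by (rule that)
qed

text \<open>Heine-Borel for an arbitrary norm, by induction on the spanning set. With the
  coefficient of the new vector bounded, the ball is cut out of a continuous image of a compact
  product.\<close>

lemma compact_cball_Int_span:
  fixes S :: "'a::real_normed_vector set"
  assumes "finite S"
  shows "compact (cball 0 r \<inter> span S)"
  using assms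
proof (induction S arbitrary: r rule: finite_induct)
  case empty
  have "finite (cball 0 r \<inter> span {} :: 'a set)" by simp
  then show ?case by (rule finite_imp_compact)
next
  case (insert b S)
  show ?case
  proof (cases "b \<in> span S")
    case True
    then show ?thesis using insert.IH span_redundant[of b S] by simp
  next
    case False
    have "closed (span S)" by (rule closed_if_compact_Int_cball) (rule insert.IH)
    then obtain e where e: "e > 0" "\<And>k s. s \<in> span S \<Longrightarrow> e * \<bar>k\<bar> \<le> norm (k *\<^sub>R b + s)"
      using span_insert_coeff_bound False by blast
    \<comment> \<open>If \<open>k *\<^sub>R b + s\<close> has norm at most \<open>r\<close>, the
      coefficient bound gives the interval for \<open>k\<close>, and the triangle inequality then
      gives the radius for \<open>s\<close>.\<close>
    define K where "K = {- (r / e)..r / e} \<times> (cball 0 (r + r / e * norm b) \<inter> span S)"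
    define f where "f = (\<lambda>(k, s). k *\<^sub>R b + s)"
    have "compact K" unfolding K_def using insert.IH by (intro compact_Times) auto
    moreover have "continuous_on K f"
      unfolding f_def case_prod_beta by (intro continuous_intros)
    ultimately have "compact (f ` K)" by (rule compact_continuous_image[rotated])
    moreover have "cball 0 r \<inter> span (insert b S) = cball 0 r \<inter> f ` K"
    proof (intro equalityI subsetI)
      fix x assume x: "x \<in> cball 0 r \<inter> span (insert b S)"
      then obtain k where k: "x - k *\<^sub>R b \<in> span S" by (auto simp: span_insert)
      have "e * \<bar>k\<bar> \<le> norm x" using e(2)[OF k, of k] by simp
      then have "e * \<bar>k\<bar> \<le> r" using x by auto
      then have kr: "\<bar>k\<bar> \<le> r / e" using e(1) by (simp add: field_simps)
      have "norm (x - k *\<^sub>R b) \<le> norm x + \<bar>k\<bar> * norm b"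
        using norm_triangle_ineq4[of x "k *\<^sub>R b"] by simp
      also have "\<dots> \<le> r + r / e * norm b"
        using x kr by (intro add_mono mult_right_mono) auto
      finally have "(k, x - k *\<^sub>R b) \<in> K" using k kr by (auto simp: K_def)
      then show "x \<in> cball 0 r \<inter> f ` K" using x by (force simp: f_def)
    next
      fix x assume "x \<in> cball 0 r \<inter> f ` K"
      then obtain k s where "s \<in> span S" "x = k *\<^sub>R b + s" "norm x \<le> r"
        by (auto simp: K_def f_def)
      then show "x \<in> cball 0 r \<inter> span (insert b S)"
        by (auto simp: span_insert intro!: exI[of _ k])
    qed
    ultimately show ?thesis by (simp add: closed_Int_compact)
  qed
qed

text \<open>Same induction: the coefficient of \<open>b\<close> is at most
  \<open>norm x / e\<close>, which also bounds the remainder in the smaller span. The coordinate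
  functionals are thereby continuous.\<close>

lemma linear_bounded_on_span:
  fixes S :: "'a::real_normed_vector set" and f :: "'a \<Rightarrow> real"
  assumes "finite S" "linear f"
  shows "\<exists>K\<ge>0. \<forall>x\<in>span S. \<bar>f x\<bar> \<le> K * norm x"
  using assms(1)
proof (induction S rule: finite_induct)
  case empty
  then show ?case using linear_0[OF assms(2)] by (auto intro!: exI[of _ 0])
next
  case (insert b S)
  show ?case
  proof (cases "b \<in> span S")
    case True
    then show ?thesis using insert.IH span_redundant[of b S] by simp
  next
    case False
    have "closed (span S)"
      by (rule closed_if_compact_Int_cball) (rule compact_cball_Int_span[OF insert.hyps(1)])
    then obtain e where e: "e > 0" "\<And>k s. s \<in> span S \<Longrightarrow> e * \<bar>k\<bar> \<le> norm (k *\<^sub>R b + s)"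
      using span_insert_coeff_bound False by blast
    obtain K where K: "K \<ge> 0" "\<And>x. x \<in> span S \<Longrightarrow> \<bar>f x\<bar> \<le> K * norm x"
      using insert.IH by blast
    have "\<bar>f x\<bar> \<le> (\<bar>f b\<bar> / e + K * (1 + norm b / e)) * norm x" if x: "x \<in> span (insert b S)" for x
    proof -
      obtain k where k: "x - k *\<^sub>R b \<in> span S" using x by (auto simp: span_insert)
      have "e * \<bar>k\<bar> \<le> norm x" using e(2)[OF k, of k] by simp
      then have kr: "\<bar>k\<bar> \<le> norm x / e" using e(1) by (simp add: field_simps)
      have "f x = k * f b + f (x - k *\<^sub>R b)"
        using assms(2) by (simp add: linear_diff linear_scale)
      then have "\<bar>f x\<bar> \<le> \<bar>k\<bar> * \<bar>f b\<bar> + \<bar>f (x - k *\<^sub>R b)\<bar>"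
        by (metis abs_mult abs_triangle_ineq)
      also have "\<dots> \<le> \<bar>k\<bar> * \<bar>f b\<bar> + K * (norm x + \<bar>k\<bar> * norm b)"
        using K(2)[OF k] norm_triangle_ineq4[of x "k *\<^sub>R b"] K(1)
        by (smt (verit) mult_left_mono norm_scaleR)
      also have "\<dots> \<le> norm x / e * \<bar>f b\<bar> + K * (norm x + norm x / e * norm b)"
        using kr K(1) by (intro add_mono mult_mono mult_right_mono) auto
      finally show ?thesis by (simp add: algebra_simps)
    qed
    then show ?thesis using K(1) e(1)
      by (intro exI[of _ "\<bar>f b\<bar> / e + K * (1 + norm b / e)"]) simp
  qed
qed

text \<open>The squared coordinates will serve as a smooth quadratic regularizer, which the norm of
  the space need not provide.\<close>

lemma finite_dim_bounded_coordinates: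
  fixes B :: "'a::real_normed_vector set"
  assumes "finite B" "span B = UNIV"
  obtains I and c :: "'a \<Rightarrow> 'a \<Rightarrow>\<^sub>L real"
  where "finite I" "\<And>x. x = (\<Sum>b\<in>I. blinfun_apply (c b) x *\<^sub>R b)"
proof -
  obtain I where I: "I \<subseteq> B" "independent I" "span I = UNIV"
    using maximal_independent_subset[of B] assms(2)
    by (metis span_mono span_span top.extremum_uniqueI)
  then have fI: "finite I" using assms(1) finite_subset by blast
  have "bounded_linear (\<lambda>x. representation I x b)" for b
  proof -
    have lin: "linear (\<lambda>x. representation I x b)"
      using I by (auto intro!: linearI simp: representation_add representation_scale)
    obtain K where "\<And>x. \<bar>representation I x b\<bar> \<le> K * norm x"
      using linear_bounded_on_span[OF assms(1) lin] assms(2) by auto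
    then show ?thesis
      using linear_add[OF lin] linear_scale[OF lin]
      by (intro bounded_linear_intro[where K = K]) (auto simp: mult.commute)
  qed
  then have "blinfun_apply (Blinfun (\<lambda>x. representation I x b)) = (\<lambda>x. representation I x b)" for b
    by (rule bounded_linear_Blinfun_apply)
  moreover have "x = (\<Sum>b\<in>I. representation I x b *\<^sub>R b)" for x
    using I fI by (simp add: sum_representation_eq)
  ultimately show thesis
    using that[of I "\<lambda>b. Blinfun (\<lambda>x. representation I x b)"] fI by simp
qed

lemma finite_dim_compact:
  fixes S B :: "'a::real_normed_vector set"
  assumes "finite B" "span B = UNIV" "closed S" "bounded S"
  shows "compact S"
proof -
  obtain r where "S \<subseteq> cball 0 r"
    using assms(4) by (meson bounded_subset_ballD ball_subset_cball order.trans)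
  then have "S = S \<inter> (cball 0 r \<inter> span B)" using assms(2) by auto
  then show ?thesis
    using compact_cball_Int_span[OF assms(1), of r] assms(3)
    by (metis closed_Int_compact)
qed

section \<open>Bregman steps\<close>

text \<open>The minimizers of \<open>d + n q(\<cdot> - x)\<close>, where \<open>q\<close> is the sum of the squared coordinates, are
  points with a subgradient, and they tend to \<open>x\<close> as \<open>n\<close> grows.\<close>

lemma subgrad_dom_dense:
  fixes B Lam :: "'a::real_normed_vector set"
  assumes fin: "finite B" "span B = UNIV"
    and Lam: "closed Lam" "convex Lam"
    and d: "continuous_on Lam d" "convex_on Lam d"
    and bdd: "\<And>r. bounded {z \<in> Lam. d z \<le> r}"
    and x: "x \<in> Lam"
  shows "x \<in> closure (subgrad_dom Lam d)"
proof -
  obtain I and c :: "'a \<Rightarrow> 'a \<Rightarrow>\<^sub>L real"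
    where I: "finite I" and c: "\<And>x. x = (\<Sum>b\<in>I. blinfun_apply (c b) x *\<^sub>R b)"
    using finite_dim_bounded_coordinates[OF fin] by metis
  define q where "q v = (\<Sum>b\<in>I. (c b v)\<^sup>2)" for v
  have q0: "q v \<ge> 0" for v unfolding q_def by (simp add: sum_nonneg)
  have q_norm: "norm v \<le> sqrt (q v) * (\<Sum>b\<in>I. norm b)" for v
  proof -
    have "\<bar>c b v\<bar> \<le> sqrt (q v)" if "b \<in> I" for b
      unfolding q_def using that I
      by (intro real_le_rsqrt) (auto intro!: member_le_sum[where f = "\<lambda>b. (c b v)\<^sup>2"])
    then have "(\<Sum>b\<in>I. norm (c b v *\<^sub>R b)) \<le> (\<Sum>b\<in>I. sqrt (q v) * norm b)"
      by (intro sum_mono) (auto intro: mult_right_mono)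
    then show ?thesis
      using norm_sum[of "\<lambda>b. c b v *\<^sub>R b" I] c[of v] by (simp add: sum_distrib_left)
  qed
  define K where "K = {z \<in> Lam. d z \<le> d x}"
  have "closed K" unfolding K_def
    using continuous_closedin_preimage[OF d(1), of "{..d x}"] Lam(1)
    by (auto simp: closedin_closed_eq vimage_def Int_def)
  then have K: "compact K" "x \<in> K" "K \<subseteq> Lam" using finite_dim_compact[OF fin] bdd x by (auto simp: K_def)
  obtain m where m: "\<And>z. z \<in> K \<Longrightarrow> m \<le> d z"
    using continuous_attains_inf[OF K(1), of d] K(2) continuous_on_subset[OF d(1) K(3)] by blast
  have "\<exists>z\<in>subgrad_dom Lam d. norm (z - x) < e" if e: "e > 0" for e
  proof -
    define s where "s = 1 + (\<Sum>b\<in>I. norm b)"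
    have s: "s > 0" unfolding s_def by (simp add: sum_nonneg add_pos_nonneg)
    \<comment> \<open>Any minimizer \<open>z\<close> satisfies
      \<open>n * q (z - x) \<le> d x - m\<close>. This \<open>n\<close> turns that into
      \<open>norm (z - x) < e\<close>; the summand 1 keeps \<open>n\<close> positive when
      \<open>d x = m\<close>.\<close>
    define n where "n = (1 + d x - m) * s\<^sup>2 / e\<^sup>2"
    have n: "n > 0" using m[OF K(2)] s e by (auto simp: n_def)
    have "continuous_on K (\<lambda>w. d w + n * q (w - x))"
      unfolding q_def using d(1) K(3) by (auto intro!: continuous_intros intro: continuous_on_subset)
    then obtain z where zK: "z \<in> K" and zmin: "\<And>w. w \<in> K \<Longrightarrow> d z + n * q (z - x) \<le> d w + n * q (w - x)"
      using continuous_attains_inf[OF K(1)] K(2) by blast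
    have zx: "d z + n * q (z - x) \<le> d x"
      using zmin[OF K(2)] by (simp add: q_def)
    \<comment> \<open>Minimality extends from the compact sublevel set to \<open>Lam\<close>:
      outside of it \<open>d w\<close> exceeds \<open>d x\<close>, which already dominates the value
      at \<open>z\<close>.\<close>
    have zall: "d z + n * q (z - x) \<le> d w + n * q (w - x)" if "w \<in> Lam" for w
    proof (cases "w \<in> K")
      case False
      then have "d x < d w" using that by (auto simp: K_def)
      then show ?thesis using zx mult_nonneg_nonneg[of n "q (w - x)"] n q0[of "w - x"] by linarith
    qed (rule zmin)
    define b where "b w = (\<Sum>i\<in>I. c i (z - x) * c i w)" for w
    \<comment> \<open>Minus the derivative of \<open>n * q (w - x)\<close> in \<open>w\<close> at
      \<open>z\<close>; first-order optimality makes it a subgradient of \<open>d\<close>.\<close>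
    define h where "h = (- 2 * n) *\<^sub>R (\<Sum>i\<in>I. c i (z - x) *\<^sub>R c i)"
    have h: "h w = - 2 * n * b w" for w
      by (simp add: h_def b_def blinfun.sum_left blinfun.scaleR_left blinfun.minus_left)
    have "d z + h (w - z) \<le> d w" if w: "w \<in> Lam" for w
    proof -
      \<comment> \<open>Minimality of \<open>z\<close> is tested at a point of the segment towards
        \<open>w\<close> and divided by \<open>t\<close>; the quadratic remainder vanishes as
        \<open>t\<close> tends to 0.\<close>
      have *: "0 \<le> d w - d z + 2 * n * b (w - z) + t * (n * q (w - z))" if t: "0 < t" "t < 1" for t
      proof -
        define u where "u = (1 - t) *\<^sub>R z + t *\<^sub>R w"
        have u: "u \<in> Lam" unfolding u_def using Lam(2) zK K(3) w t by (intro convexD) auto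
        have "d u \<le> (1 - t) * d z + t * d w"
          unfolding u_def using convex_onD[OF d(2), of t z w] t zK K(3) w by auto
        moreover have "u - x = (z - x) + t *\<^sub>R (w - z)" by (simp add: u_def algebra_simps)
        then have "q (u - x) = q (z - x) + 2 * t * b (w - z) + t\<^sup>2 * q (w - z)"
          by (simp only: q_def b_def blinfun.add_right blinfun.scaleR_right power2_sum
              power_mult_distrib sum.distrib sum_distrib_left real_scaleR_def mult_ac)
        ultimately have "0 \<le> t * (d w - d z + 2 * n * b (w - z) + t * (n * q (w - z)))"
          using zall[OF u] by (simp add: algebra_simps power2_eq_square)
        then show ?thesis using t by (simp add: zero_le_mult_iff)
      qed
      have "((\<lambda>t. d w - d z + 2 * n * b (w - z) + t * (n * q (w - z))) \<longlongrightarrow>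
          d w - d z + 2 * n * b (w - z) + 0 * (n * q (w - z))) (at_right 0)"
        by (intro tendsto_intros)
      moreover have "\<forall>\<^sub>F t in at_right 0. 0 \<le> d w - d z + 2 * n * b (w - z) + t * (n * q (w - z))"
        using eventually_at_right_real[of 0 1] by (rule eventually_mono) (use * in auto)
      ultimately have "0 \<le> d w - d z + 2 * n * b (w - z) + 0 * (n * q (w - z))"
        by (rule tendsto_lowerbound) auto
      then show ?thesis by (simp add: h)
    qed
    then have "z \<in> subgrad_dom Lam d" using zK K(3) by (auto simp: subgrad_dom_def)
    moreover have "norm (z - x) < e"
    proof -
      have "n * q (z - x) < 1 + d x - m" using zx m[OF zK] by linarith
      then have "(1 + d x - m) * (q (z - x) * s\<^sup>2) < (1 + d x - m) * e\<^sup>2"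
        using e by (simp add: n_def pos_divide_less_eq mult_ac)
      then have "q (z - x) * s\<^sup>2 < e\<^sup>2"
        using m[OF K(2)] by simp
      then have "sqrt (q (z - x) * s\<^sup>2) < sqrt (e\<^sup>2)" by (rule real_sqrt_less_mono)
      then have "sqrt (q (z - x)) * s < e" using s e by (simp add: real_sqrt_mult)
      moreover have "sqrt (q (z - x)) * (\<Sum>b\<in>I. norm b) \<le> sqrt (q (z - x)) * s"
        using q0 by (intro mult_left_mono) (auto simp: s_def)
      ultimately show ?thesis using q_norm[of "z - x"] by linarith
    qed
    ultimately show ?thesis by blast
  qed
  then show ?thesis by (auto simp: closure_approachable dist_norm)
qed

text \<open>Strong convexity at \<open>x0\<close> makes \<open>d\<close> grow quadratically, which
  outweighs the linear term of slope at most \<open>N\<close>. Beyond \<open>R\<close> the growth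
  exceeds what \<open>d z \<le> r\<close> allows.\<close>

lemma prox_sublevel_bounded:
  fixes Lam :: "'a::real_normed_vector set"
  assumes prox: "prox_setup Lam d gd" and x0: "x0 \<in> subgrad_dom Lam d"
  shows "bounded {z \<in> Lam. d z \<le> r}"
proof -
  define N where "N = norm (gd x0)"
  define R where "R = 2 * N + 1 + 2 * \<bar>r - d x0\<bar>"
  have "norm (z - x0) \<le> R" if "z \<in> Lam" "d z \<le> r" for z
  proof (rule ccontr)
    assume "\<not> ?thesis"
    then have gt: "norm (z - x0) > R" by simp
    have "1 / 2 * (norm (z - x0))\<^sup>2 \<le> d z - d x0 - gd x0 (z - x0)"
      using prox x0 that unfolding prox_setup_def by blast
    moreover have "- gd x0 (z - x0) \<le> N * norm (z - x0)"
      using norm_blinfun[of "gd x0" "z - x0"] by (simp add: N_def)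
    ultimately have "(norm (z - x0))\<^sup>2 - 2 * (N * norm (z - x0)) \<le> 2 * \<bar>r - d x0\<bar>"
      using that(2) abs_ge_self[of "r - d x0"] by argo
    then have "norm (z - x0) * (norm (z - x0) - 2 * N) \<le> 2 * \<bar>r - d x0\<bar>"
      by (simp add: algebra_simps power2_eq_square)
    moreover have "N \<ge> 0" by (simp add: N_def)
    then have "1 * (1 + 2 * \<bar>r - d x0\<bar>) \<le> norm (z - x0) * (norm (z - x0) - 2 * N)"
      using gt abs_ge_zero[of "r - d x0"] unfolding R_def by (intro mult_mono) argo+
    ultimately show False by argo
  qed
  then have "{z \<in> Lam. d z \<le> r} \<subseteq> cball x0 R"
    by (auto simp: dist_norm norm_minus_commute)
  then show ?thesis using bounded_cball bounded_subset by blast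
qed

text \<open>The minimality of \<open>x\<close> only shows that \<open>- p\<close> is some subgradient of \<open>d\<close> at \<open>x\<close>. That the
  selected subgradient \<open>gd x\<close> satisfies the variational inequality as well needs the continuity
  of the selection: the inequality is obtained at points \<open>z\<close> of the dense set \<^term>\<open>subgrad_dom Lam d\<close>
  within distance \<open>t\<^sup>2\<close> of \<open>x + t (y - x)\<close>, and passes to the limit \<open>t \<rightarrow> 0\<close> after division by \<open>t\<close>.\<close>

lemma prox_minimizer:
  fixes B Lam :: "'a::real_normed_vector set" and p :: "'a \<Rightarrow>\<^sub>L real"
  assumes fin: "finite B" "span B = UNIV"
    and Lam: "closed Lam" "convex Lam"
    and prox: "prox_setup Lam d gd"
    and x: "x \<in> Lam" and xmin: "\<And>y. y \<in> Lam \<Longrightarrow> d x + p x \<le> d y + p y"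
  shows "x \<in> subgrad_dom Lam d" and "y \<in> Lam \<Longrightarrow> 0 \<le> (gd x + p) (y - x)"
proof -
  have "d x + (- p) (y - x) \<le> d y" if "y \<in> Lam" for y
    using xmin[OF that] by (simp add: blinfun.minus_left blinfun.diff_right)
  then show xs: "x \<in> subgrad_dom Lam d" using x unfolding subgrad_dom_def by blast
  assume y: "y \<in> Lam"
  define t where "t n = 1 / real (Suc n)" for n
  have t: "0 < t n" "t n \<le> 1" for n by (auto simp: t_def)
  have t0: "t \<longlonglongrightarrow> 0" unfolding t_def using LIMSEQ_inverse_real_of_nat by (simp add: inverse_eq_divide)
  have "\<exists>z\<in>subgrad_dom Lam d. norm (z - (x + t n *\<^sub>R (y - x))) < (t n)\<^sup>2" for n
  proof -
    have "(1 - t n) *\<^sub>R x + t n *\<^sub>R y \<in> Lam" using Lam(2) x y t[of n] by (intro convexD) auto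
    also have "(1 - t n) *\<^sub>R x + t n *\<^sub>R y = x + t n *\<^sub>R (y - x)" by (simp add: algebra_simps)
    finally have "x + t n *\<^sub>R (y - x) \<in> closure (subgrad_dom Lam d)"
      using prox prox_sublevel_bounded[OF prox xs] unfolding prox_setup_def
      by (intro subgrad_dom_dense[OF fin Lam]) auto
    then show ?thesis using t(1)[of n] by (auto simp: closure_approachable dist_norm)
  qed
  then obtain z where zs: "\<And>n. z n \<in> subgrad_dom Lam d"
    and zn: "\<And>n. norm (z n - (x + t n *\<^sub>R (y - x))) < (t n)\<^sup>2" by metis
  \<comment> \<open>The rescaled displacement tends to \<open>y - x\<close>, because an error below
    \<open>(t n)\<^sup>2\<close> remains below \<open>t n\<close> after division by
    \<open>t n\<close>.\<close>
  define v where "v n = (1 / t n) *\<^sub>R (z n - x)" for n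
  have zv: "z n = x + t n *\<^sub>R v n" for n using t(1)[of n] by (simp add: v_def)
  have vn: "norm (v n - (y - x)) \<le> t n" for n
  proof -
    have "z n - (x + t n *\<^sub>R (y - x)) = t n *\<^sub>R (v n - (y - x))" by (simp add: zv algebra_simps)
    then have "t n * norm (v n - (y - x)) < t n * t n"
      using zn[of n] t(1)[of n] by (simp add: power2_eq_square)
    then show ?thesis using t(1)[of n] by simp
  qed
  have v: "v \<longlonglongrightarrow> y - x"
    by (rule LIM_zero_cancel, rule Lim_null_comparison[OF _ t0]) (use vn in simp)
  have "(\<lambda>n. x + t n *\<^sub>R v n) \<longlonglongrightarrow> x + 0 *\<^sub>R (y - x)" by (intro tendsto_intros t0 v)
  then have z: "z \<longlonglongrightarrow> x" by (simp add: zv[symmetric])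
  have "(\<lambda>n. gd (z n)) \<longlonglongrightarrow> gd x"
    using prox xs zs z unfolding prox_setup_def
    by (intro continuous_on_tendsto_compose[of "subgrad_dom Lam d" gd]) auto
  then have lim: "(\<lambda>n. (gd (z n) + p) (v n)) \<longlonglongrightarrow> (gd x + p) (y - x)"
    by (intro tendsto_intros v)
  have "0 \<le> (gd (z n) + p) (v n)" for n
  proof -
    have zL: "z n \<in> Lam" using zs by (auto simp: subgrad_dom_def)
    \<comment> \<open>The subgradient inequality at \<open>z n\<close>, tested at \<open>x\<close>,
      is added to the minimality of \<open>x\<close>, tested at \<open>z n\<close>; the values of
      \<open>d\<close> cancel.\<close>
    have "d (z n) + gd (z n) (x - z n) \<le> d x"
      using prox zs x unfolding prox_setup_def by blast
    then have "0 \<le> (gd (z n) + p) (z n - x)"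
      using xmin[OF zL] by (simp add: blinfun.add_left blinfun.diff_right)
    then have "0 \<le> t n * (gd (z n) + p) (v n)" by (simp add: zv blinfun.scaleR_right)
    then show ?thesis using t(1)[of n] by (simp add: zero_le_mult_iff)
  qed
  then show "0 \<le> (gd x + p) (y - x)" by (intro tendsto_lowerbound[OF lim]) auto
qed

lemma bregman_ge:
  assumes "prox_setup Lam d gd" "z \<in> subgrad_dom Lam d" "x \<in> Lam"
  shows "bregman d gd z x \<ge> 1 / 2 * (norm (x - z))\<^sup>2"
  using assms unfolding prox_setup_def bregman_def by blast

text \<open>The identity \<open>V[z](x) - V[z](z') - V[z'](x) = (gd z' - gd z) (x - z')\<close>
  reduces the inequality to the variational inequality at the minimizer. Up to a constant the
  objective is \<open>d + p\<close>, with \<open>p\<close> linear.\<close>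

lemma bregman_three_point:
  fixes B Lam :: "'a::real_normed_vector set"
  assumes fin: "finite B" "span B = UNIV"
    and Lam: "closed Lam" "convex Lam"
    and prox: "prox_setup Lam d gd"
    and min: "is_arg_min (\<lambda>x. bregman d gd z x + a * linearization phi g l x) (\<lambda>x. x \<in> Lam) z'"
  shows "z' \<in> subgrad_dom Lam d"
    and "x \<in> Lam \<Longrightarrow> bregman d gd z z' + a * linearization phi g l z' + bregman d gd z' x
           \<le> bregman d gd z x + a * linearization phi g l x"
proof -
  define p where "p = a *\<^sub>R g l - gd z"
  have eq: "bregman d gd z x + a * linearization phi g l x
      = d x + p x + (a * phi l - a * g l l - d z + gd z z)" for x
    by (simp add: bregman_def linearization_def p_def blinfun.diff_left blinfun.scaleR_left
        blinfun.diff_right algebra_simps)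
  have z': "z' \<in> Lam" and zmin: "\<And>y. y \<in> Lam \<Longrightarrow> d z' + p z' \<le> d y + p y"
    using min unfolding is_arg_min_def eq by (auto simp: not_less)
  show "z' \<in> subgrad_dom Lam d"
    by (rule prox_minimizer(1)[OF fin Lam prox z' zmin])
  assume x: "x \<in> Lam"
  have "0 \<le> (gd z' + p) (x - z')"
    by (rule prox_minimizer(2)[OF fin Lam prox z' zmin x])
  then show "bregman d gd z z' + a * linearization phi g l z' + bregman d gd z' x
           \<le> bregman d gd z x + a * linearization phi g l x"
    unfolding eq by (simp add: bregman_def blinfun.add_left blinfun.diff_right)
qed

section \<open>Smooth convex functions\<close>

text \<open>Convexity bounds the difference quotients along the segment by
  \<open>phi y - phi x\<close>; their right limit at 0 is the directional derivative.\<close>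

lemma linearization_le:
  fixes phi :: "'a::real_normed_vector \<Rightarrow> real"
  assumes "convex_on UNIV phi" "(phi has_derivative blinfun_apply (g x)) (at x)"
  shows "linearization phi g x y \<le> phi y"
proof -
  have "((\<lambda>t. phi (x + t *\<^sub>R (y - x))) has_derivative (\<lambda>t. g x (t *\<^sub>R (y - x)))) (at (0::real))"
    by (rule has_derivative_compose[where f = "\<lambda>t. x + t *\<^sub>R (y - x)" and g = phi])
       (use assms(2) in \<open>auto intro!: derivative_eq_intros\<close>)
  then have der: "((\<lambda>t. phi (x + t *\<^sub>R (y - x))) has_real_derivative g x (y - x)) (at 0)"
    by (simp add: has_field_derivative_def blinfun.scaleR_right mult_commute_abs)
  have "((\<lambda>t. (phi (x + t *\<^sub>R (y - x)) - phi x) / t) \<longlongrightarrow> g x (y - x)) (at_right 0)"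
    using der unfolding has_field_derivative_iff by (auto intro: filterlim_at_split[THEN iffD1, THEN conjunct2])
  moreover have "\<forall>\<^sub>F t in at_right 0. (phi (x + t *\<^sub>R (y - x)) - phi x) / t \<le> phi y - phi x"
  proof (rule eventually_mono[OF eventually_at_right_real[of 0 1]])
    fix t :: real assume "t \<in> {0<..<1}"
    then have "phi ((1 - t) *\<^sub>R x + t *\<^sub>R y) \<le> (1 - t) * phi x + t * phi y" "0 < t"
      using convex_onD[OF assms(1), of t x y] by auto
    moreover have "(1 - t) *\<^sub>R x + t *\<^sub>R y = x + t *\<^sub>R (y - x)" by (simp add: algebra_simps)
    ultimately show "(phi (x + t *\<^sub>R (y - x)) - phi x) / t \<le> phi y - phi x"
      by (simp add: field_simps)
  qed simp
  ultimately have "g x (y - x) \<le> phi y - phi x" by (rule tendsto_upperbound) auto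
  then show ?thesis by (simp add: linearization_def)
qed

text \<open>Instead of integrating the gradient, the auxiliary function \<open>h\<close> is shown to
  be nonincreasing on the unit interval: the Lipschitz bound makes its derivative
  nonpositive.\<close>

lemma descent_lemma:
  fixes phi :: "'a::real_normed_vector \<Rightarrow> real"
  assumes grad: "\<And>x. (phi has_derivative blinfun_apply (g x)) (at x)"
    and smooth: "\<And>x y. norm (g x - g y) \<le> L * norm (x - y)"
  shows "phi y \<le> linearization phi g x y + L / 2 * (norm (y - x))\<^sup>2"
proof -
  define v where "v = y - x"
  define h where "h t = phi (x + t *\<^sub>R v) - t * g x v - L / 2 * t\<^sup>2 * (norm v)\<^sup>2" for t
  have "((\<lambda>t. phi (x + t *\<^sub>R v)) has_derivative (\<lambda>s. g (x + t *\<^sub>R v) (s *\<^sub>R v))) (at t)" for t :: real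
    by (rule has_derivative_compose[where f = "\<lambda>t. x + t *\<^sub>R v" and g = phi])
       (use grad in \<open>auto intro!: derivative_eq_intros\<close>)
  then have "((\<lambda>t. phi (x + t *\<^sub>R v)) has_real_derivative g (x + t *\<^sub>R v) v) (at t)" for t
    by (simp add: has_field_derivative_def blinfun.scaleR_right mult_commute_abs)
  then have der: "(h has_real_derivative g (x + t *\<^sub>R v) v - g x v - L * t * (norm v)\<^sup>2) (at t)" for t
    unfolding h_def by (auto intro!: derivative_eq_intros)
  have "h 1 \<le> h 0"
  proof (rule DERIV_nonpos_imp_nonincreasing[of 0 1 h])
    fix t :: real assume t: "0 \<le> t"
    have "(g (x + t *\<^sub>R v) - g x) v \<le> norm (g (x + t *\<^sub>R v) - g x) * norm v"
      using norm_blinfun[of "g (x + t *\<^sub>R v) - g x" v] by simp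
    also have "\<dots> \<le> (L * norm (t *\<^sub>R v)) * norm v"
      using smooth[of "x + t *\<^sub>R v" x] by (intro mult_right_mono) auto
    finally have "g (x + t *\<^sub>R v) v - g x v - L * t * (norm v)\<^sup>2 \<le> 0"
      using t by (simp add: blinfun.diff_left power2_eq_square mult_ac)
    then show "\<exists>y. (h has_real_derivative y) (at t) \<and> y \<le> 0" using der by blast
  qed simp
  then show ?thesis by (simp add: h_def v_def linearization_def)
qed

section \<open>Convergence of the method\<close>

text \<open>The quadratic formula gives a positive root \<open>b\<close>, and \<open>a\<close> is
  the largest root.\<close>

lemma trial_pos:
  assumes "astm_trial Lam phi g d gd C z e M a C' l z' e'" "M > 0" "C \<ge> 0"
  shows "a > 0"
proof -
  define b where "b = (1 + sqrt (1 + 4 * M * C)) / (2 * M)"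
  have s: "(sqrt (1 + 4 * M * C))\<^sup>2 = 1 + 4 * M * C" using assms by simp
  have "M * b\<^sup>2 = (1 + 2 * sqrt (1 + 4 * M * C) + (sqrt (1 + 4 * M * C))\<^sup>2) / (4 * M)"
    using assms(2) by (simp add: b_def power_divide power2_sum field_simps) (simp add: power2_eq_square)
  also have "\<dots> = C + b" unfolding s using assms(2) by (simp add: b_def field_simps)
  finally have "b \<le> a" using assms(1) by (simp add: astm_trial_def)
  moreover have "b > 0" using assms by (simp add: b_def add_pos_nonneg)
  ultimately show ?thesis by simp
qed

lemma inner_exit:
  assumes "astm_inner Lam phi g d gd C z e M M' a C' l z' e'"
    and "M > 0" "M \<le> L"
    and "\<And>x y. phi y \<le> linearization phi g x y + L / 2 * (norm (y - x))\<^sup>2"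
  shows "astm_trial Lam phi g d gd C z e M' a C' l z' e' \<and> astm_check phi g M' l e' \<and>
    0 < M' \<and> M' \<le> 2 * L"
  using assms
proof (induction rule: astm_inner.induct)
  case (reject M b D l0 z0 e0 M' a C' l z' e')
  \<comment> \<open>A trial constant above \<open>L\<close> would pass the check. So
    \<open>M \<le> L\<close> persists through rejections, and the accepted constant is one doubling
    of such a value.\<close>
  have "2 * M \<le> L"
  proof (rule ccontr)
    assume "\<not> 2 * M \<le> L"
    then have "L / 2 * (norm (e0 - l0))\<^sup>2 \<le> 2 * M / 2 * (norm (e0 - l0))\<^sup>2"
      by (intro mult_right_mono) auto
    then have "astm_check phi g (2 * M) l0 e0"
      using reject.prems(3)[of e0 l0] unfolding astm_check_def by linarith
    then show False using reject.hyps by simp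
  qed
  then show ?case using reject by auto
qed auto

lemma potential_decreases:
  fixes B Lam :: "'a::real_normed_vector set"
  assumes fin: "finite B" "span B = UNIV"
    and Lam: "closed Lam" "convex Lam"
    and prox: "prox_setup Lam d gd"
    and below: "\<And>x y. linearization phi g x y \<le> phi y"
    and trial: "astm_trial Lam phi g d gd C z e M a C' l z' e'"
    and check: "astm_check phi g M l e'"
    and pos: "M > 0" "C \<ge> 0"
    and z: "z \<in> subgrad_dom Lam d" and x: "x \<in> Lam"
  shows "C' * (phi e' - phi x) + bregman d gd z' x \<le> C * (phi e - phi x) + bregman d gd z x"
proof -
  have a: "a > 0" using trial_pos[OF trial pos] .
  have C': "C' = C + a" "C' = M * a\<^sup>2" and l: "l = (a *\<^sub>R z + C *\<^sub>R e) /\<^sub>R C'"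
    and e': "e' = (a *\<^sub>R z' + C *\<^sub>R e) /\<^sub>R C'"
    and min: "is_arg_min (\<lambda>x. bregman d gd z x + a * linearization phi g l x) (\<lambda>x. x \<in> Lam) z'"
    using trial by (auto simp: astm_trial_def)
  have C'pos: "C' > 0" using C' a pos by linarith
  note three = bregman_three_point[OF fin Lam prox min]
  have "z' \<in> Lam" using min by (simp add: is_arg_min_def)
  then have V: "1 / 2 * (norm (z' - z))\<^sup>2 \<le> bregman d gd z z'" by (rule bregman_ge[OF prox z])
  \<comment> \<open>Only the \<open>zeta\<close> component differs between \<open>e'\<close> and
    \<open>l\<close>. Since \<open>C' = M * a\<^sup>2\<close>, the weighted error of the check
    becomes exactly the strong convexity lower bound for \<open>V[z](z')\<close>.\<close>
  have "e' - l = (a / C') *\<^sub>R (z' - z)"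
    by (simp add: e' l algebra_simps divide_inverse)
  then have "(norm (e' - l))\<^sup>2 = (a / C')\<^sup>2 * (norm (z' - z))\<^sup>2"
    by (simp add: power_mult_distrib power_divide)
  then have "C' * (M / 2 * (norm (e' - l))\<^sup>2) = (C' * M * (a / C')\<^sup>2) * (1 / 2 * (norm (z' - z))\<^sup>2)"
    by simp
  also have "C' * M * (a / C')\<^sup>2 = 1"
    using C'pos by (simp add: power_divide C'(2)[symmetric] mult_ac) (simp add: C'(2) power2_eq_square)
  finally have quad: "C' * (M / 2 * (norm (e' - l))\<^sup>2) = 1 / 2 * (norm (z' - z))\<^sup>2" by simp
  have "C' *\<^sub>R e' = a *\<^sub>R z' + C *\<^sub>R e" using C'pos by (simp add: e')
  then have "C' * g l e' = a * g l z' + C * g l e"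
    by (metis blinfun.add_right blinfun.scaleR_right real_scaleR_def)
  then have lin: "C' * linearization phi g l e' = a * linearization phi g l z' + C * linearization phi g l e"
    unfolding linearization_def blinfun.diff_right C'(1) by (simp add: algebra_simps)
  have "C' * phi e' \<le> C' * (linearization phi g l e' + M / 2 * (norm (e' - l))\<^sup>2)"
    using check C'pos by (intro mult_left_mono) (auto simp: astm_check_def)
  also have "\<dots> = a * linearization phi g l z' + C * linearization phi g l e + 1 / 2 * (norm (z' - z))\<^sup>2"
    by (simp only: distrib_left lin quad)
  also have "\<dots> \<le> bregman d gd z x + a * linearization phi g l x - bregman d gd z' x
      + C * linearization phi g l e"
    using three(2)[OF x] V by linarith
  also have "\<dots> \<le> bregman d gd z x + a * phi x - bregman d gd z' x + C * phi e"
    using mult_left_mono[OF below[of l x], of a] mult_left_mono[OF below[of l e], of C] a pos(2)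
    by linarith
  finally show ?thesis by (simp add: C'(1) algebra_simps)
qed

text \<open>In terms of \<open>u = sqrt C'\<close> the equation \<open>C' = M a\<^sup>2\<close> gives \<open>C = u\<^sup>2 - u / sqrt M \<le> (u - 1 / (2 sqrt M))\<^sup>2\<close>.\<close>

lemma sqrt_weight_step:
  fixes M a C L :: real
  assumes "C + a = M * a\<^sup>2" "0 < M" "M \<le> 2 * L" "0 < a" "0 \<le> C"
  shows "sqrt C + 1 / sqrt (8 * L) \<le> sqrt (C + a)"
proof -
  define u where "u = sqrt (C + a)"
  define m where "m = 1 / (2 * sqrt M)"
  have m: "m > 0" using assms by (simp add: m_def)
  have um: "u = sqrt M * a" unfolding u_def assms(1) using assms by (simp add: real_sqrt_mult)
  have "2 * m * u = a" using assms by (simp add: um m_def)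
  moreover have "u\<^sup>2 = C + a" unfolding u_def using assms(4,5) by simp
  ultimately have sq: "C \<le> (u - m)\<^sup>2" by (simp add: power2_diff algebra_simps)
  \<comment> \<open>Taking roots in \<open>C \<le> (u - m)\<^sup>2\<close> requires
    \<open>u - m\<close> to be nonnegative; \<open>C \<ge> 0\<close> yields even
    \<open>u \<ge> 2 * m\<close>.\<close>
  have "u * u \<ge> a" using \<open>u\<^sup>2 = C + a\<close> assms(5) by (simp add: power2_eq_square)
  then have "u * u \<ge> u * (2 * m)" using \<open>2 * m * u = a\<close> by (simp add: mult_ac)
  moreover have "u > 0" using assms by (simp add: u_def)
  ultimately have "u \<ge> 2 * m" by simp
  then have "sqrt C \<le> u - m" using sq m by (intro real_le_lsqrt) auto
  moreover have "1 / sqrt (8 * L) \<le> m"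
  proof -
    have "2 * sqrt M = sqrt (4 * M)" by (simp add: real_sqrt_mult)
    also have "\<dots> \<le> sqrt (8 * L)" using assms by simp
    finally show ?thesis unfolding m_def using assms by (intro divide_left_mono) auto
  qed
  ultimately show ?thesis by (simp add: u_def)
qed

text \<open>The bound \<open>Ls k \<le> 2 * L\<close> makes the entry constant
  \<open>Ls k / 2\<close> at most \<open>L\<close>, as the inner loop estimate requires. The growth
  bound starts at 1, since \<open>C 0 = 0\<close>.\<close>

lemma run_invariant:
  fixes B Lam :: "'a::real_normed_vector set"
  assumes fin: "finite B" "span B = UNIV"
    and Lam: "closed Lam" "convex Lam"
    and prox: "prox_setup Lam d gd"
    and below: "\<And>x y. linearization phi g x y \<le> phi y"
    and above: "\<And>x y. phi y \<le> linearization phi g x y + L / 2 * (norm (y - x))\<^sup>2"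
    and run: "astm_run Lam phi g d gd Ls M alpha C lam zeta eta"
    and guess: "Ls 0 \<le> 2 * L" and L: "L > 0"
    and x: "x \<in> Lam"
  shows "0 < Ls k \<and> Ls k \<le> 2 * L \<and> 0 \<le> C k \<and> (k \<ge> 1 \<longrightarrow> (real k + 1) / sqrt (8 * L) \<le> sqrt (C k)) \<and>
    zeta k \<in> subgrad_dom Lam d \<and>
    C k * (phi (eta k) - phi x) + bregman d gd (zeta k) x \<le> bregman d gd (zeta 0) x"
proof (induction k)
  case 0
  then show ?case using run guess by (auto simp: astm_run_def)
next
  case (Suc k)
  have inner: "astm_inner Lam phi g d gd (C k) (zeta k) (eta k) (Ls k / 2)
      (M k) (alpha (Suc k)) (C (Suc k)) (lam (Suc k)) (zeta (Suc k)) (eta (Suc k))"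
    and Ls: "Ls (Suc k) = M k / 2"
    using run by (auto simp: astm_run_def)
  have exit: "astm_trial Lam phi g d gd (C k) (zeta k) (eta k) (M k) (alpha (Suc k)) (C (Suc k))
        (lam (Suc k)) (zeta (Suc k)) (eta (Suc k))"
      "astm_check phi g (M k) (lam (Suc k)) (eta (Suc k))" "0 < M k" "M k \<le> 2 * L"
    using inner_exit[OF inner _ _ above] Suc by auto
  have a: "alpha (Suc k) > 0" using trial_pos[OF exit(1,3)] Suc by simp
  have CS: "C (Suc k) = C k + alpha (Suc k)" "C k + alpha (Suc k) = M k * (alpha (Suc k))\<^sup>2"
    using exit(1) by (auto simp: astm_trial_def)
  have "zeta (Suc k) \<in> subgrad_dom Lam d"
    using exit(1) unfolding astm_trial_def by (blast intro: bregman_three_point(1)[OF fin Lam prox])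
  moreover have "C (Suc k) * (phi (eta (Suc k)) - phi x) + bregman d gd (zeta (Suc k)) x
      \<le> bregman d gd (zeta 0) x"
    using potential_decreases[OF fin Lam prox below exit(1-3) _ _ x] Suc by force
  moreover have "(real (Suc k) + 1) / sqrt (8 * L) \<le> sqrt (C (Suc k))"
  proof (cases "k = 0")
    \<comment> \<open>From \<open>C 0 = 0\<close> the root equation gives
      \<open>alpha 1 = 1 / M 0\<close>, hence \<open>C 1 \<ge> 2\<^sup>2 / (8 * L)\<close>. This
      double first increment of the root produces \<open>k + 1\<close> rather than
      \<open>k\<close>.\<close>
    case True
    have "C 0 = 0" using run by (simp add: astm_run_def)
    then have "1 = M 0 * alpha 1" using CS a True by (simp add: power2_eq_square)
    also have "\<dots> \<le> 2 * L * alpha 1" using exit(4) a True by (intro mult_right_mono) auto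
    finally have "1 / (2 * L) \<le> alpha 1" using L by (simp add: field_simps)
    then have "1 / (2 * L) \<le> C 1" using CS(1) \<open>C 0 = 0\<close> True by simp
    moreover have "2\<^sup>2 / (8 * L) = 1 / (2 * L)" by simp
    ultimately have "sqrt (2\<^sup>2 / (8 * L)) \<le> sqrt (C 1)" by (simp only: real_sqrt_le_iff)
    then show ?thesis using True by (simp only: real_sqrt_divide real_sqrt_power) simp
  next
    case False
    have "(real (Suc k) + 1) / sqrt (8 * L) = (real k + 1) / sqrt (8 * L) + 1 / sqrt (8 * L)"
      by (simp add: add_divide_distrib)
    also have "\<dots> \<le> sqrt (C k) + 1 / sqrt (8 * L)" using Suc False by simp
    also have "\<dots> \<le> sqrt (C (Suc k))"
      using sqrt_weight_step[OF CS(2) exit(3,4) a] Suc CS(1) by simp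
    finally show ?thesis .
  qed
  ultimately show ?case using Ls exit(3,4) L CS(1) a Suc by auto
qed

text \<open>The bound on \<open>Ls 0\<close> secures the first weight: a starting constant above
  \<open>2 * L\<close> would be accepted at once and give \<open>C 1 = 1 / Ls 0\<close>, below the
  required \<open>2\<^sup>2 / (8 * L)\<close>.\<close>

theorem corollary3:
  fixes B :: "'a::real_normed_vector set"
    and Lam :: "'a set"
    and phi d :: "'a \<Rightarrow> real"
    and g gd :: "'a \<Rightarrow> 'a \<Rightarrow>\<^sub>L real"
    and L :: real
    and Ls M alpha C :: "nat \<Rightarrow> real"
    and lam zeta eta :: "nat \<Rightarrow> 'a"
    and lam_star :: 'a
    and k :: nat
  assumes finite_dim: "finite B" "span B = UNIV"
    and Lam: "Lam \<noteq> {}" "closed Lam" "convex Lam"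
    and phi_convex: "convex_on UNIV phi"
    and phi_grad: "\<And>x. (phi has_derivative blinfun_apply (g x)) (at x)"
    and L_pos: "L > 0"
    and phi_smooth: "\<And>x y. norm (g x - g y) \<le> L * norm (x - y)"
    and prox: "prox_setup Lam d gd"
    and run: "astm_run Lam phi g d gd Ls M alpha C lam zeta eta"
    and guess: "Ls 0 \<le> 2 * L"
    and lam_star: "is_arg_min (bregman d gd (zeta 0))
                     (is_arg_min phi (\<lambda>x. x \<in> Lam)) lam_star"
    and k: "k \<ge> 1"
  shows "phi (eta k) - (INF x\<in>Lam. phi x)
           \<le> 8 * L * bregman d gd (zeta 0) lam_star / (real k + 1)\<^sup>2"
proof -
  have star: "lam_star \<in> Lam" "\<And>y. y \<in> Lam \<Longrightarrow> phi lam_star \<le> phi y"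
    using lam_star by (auto simp: is_arg_min_def not_less)
  have INF: "(INF x\<in>Lam. phi x) = phi lam_star"
    using star by (intro cInf_eq_minimum) auto
  define V where "V = bregman d gd (zeta 0) lam_star"
  define D where "D = phi (eta k) - phi lam_star"
  have inv: "(real k + 1) / sqrt (8 * L) \<le> sqrt (C k)" "zeta k \<in> subgrad_dom Lam d"
    "C k * D + bregman d gd (zeta k) lam_star \<le> V" "C k \<ge> 0"
    using run_invariant[OF finite_dim Lam(2,3) prox linearization_le[OF phi_convex phi_grad]
        descent_lemma[OF phi_grad phi_smooth] run guess L_pos star(1), of k] k
    by (auto simp: V_def D_def)
  have z0: "zeta 0 \<in> subgrad_dom Lam d" using run by (simp add: astm_run_def)
  have V0: "V \<ge> 0"
    using bregman_ge[OF prox z0 star(1)] zero_le_power2[of "norm (lam_star - zeta 0)"]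
    unfolding V_def by linarith
  have CD: "C k * D \<le> V"
    using inv(3) bregman_ge[OF prox inv(2) star(1)] zero_le_power2[of "norm (lam_star - zeta k)"]
    by linarith
  have "((real k + 1) / sqrt (8 * L))\<^sup>2 \<le> (sqrt (C k))\<^sup>2"
    using inv(1) L_pos by (intro power_mono) auto
  then have Ck: "(real k + 1)\<^sup>2 / (8 * L) \<le> C k"
    using L_pos inv(4) by (simp add: power_divide)
  have "(real k + 1)\<^sup>2 / (8 * L) * D \<le> V"
  proof (cases "D \<ge> 0")
    case True
    then show ?thesis using mult_right_mono[OF Ck] CD by force
  next
    case False
    then have "(real k + 1)\<^sup>2 / (8 * L) * D \<le> 0" using L_pos by (intro mult_nonneg_nonpos) auto
    then show ?thesis using V0 by linarith
  qed
  then have "D \<le> 8 * L * V / (real k + 1)\<^sup>2" using L_pos by (simp add: field_simps)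
  then show ?thesis by (simp add: INF D_def V_def)
qed

end
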